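(* If $G$ is a (topologically) finitely generated profinite group, then the graph $\tilde\Delta_{\mathrm{virt}}(G)$ is connected and $\operatorname{diam}(\tilde\Delta_{\mathrm{virt}}(G))\leq 3$.
   Context: Generation is always topological. A generating set $X$ of a profinite group $H$ is minimal if no proper subset of $X$ topologically generates $H$. Two elements $x,y$ of a profinite group $G$ are virtually independent if there exists a minimal generating set of some open subgroup of $G$ containing both $x$ and $y$. The virtually independence graph $\tilde\Gamma_{\mathrm{virt}}(G)$ is the graph whose vertices are the elements of $G$ and in which two (distinct) vertices are joined by an edge if and only if they are virtually independent. $\tilde\Delta_{\mathrm{virt}}(G)$ is the subgraph of $\tilde\Gamma_{\mathrm{virt}}(G)$ induced by its non-isolated vertices. A graph is connected if any two of its vertices are joined by a path (a graph with no vertices counts as connected), and its diameter is the supremum of the distances between its vertices. *)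

theory Defs
  imports
    "HOL-Analysis.Analysis"
    "HOL-Algebra.Generated_Groups"
    "HOL-Library.Extended_Nat"
    "Graph_Theory.Digraph_Component"
begin

section \<open>Profinite groups and topological generation\<close>

locale topological_group = group G for G :: "('a, 'b) monoid_scheme" (structure) +
  fixes T :: "'a topology"
  assumes topspace_eq_carrier: "topspace T = carrier G"
    and continuous_mult: "continuous_map (prod_topology T T) T (\<lambda>(x, y). x \<otimes> y)"
    and continuous_inv: "continuous_map T T (\<lambda>x. inv x)"

definition totally_disconnected_space :: "'a topology \<Rightarrow> bool" where
  "totally_disconnected_space T \<longleftrightarrow> (\<forall>S. connectedin T S \<longrightarrow> (\<exists>x. S \<subseteq> {x}))"

locale profinite_group = topological_group +
  assumes compact: "compact_space T"
    and Hausdorff: "Hausdorff_space T"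
    and totally_disconnected: "totally_disconnected_space T"

definition topologically_generates ::
    "('a, 'b) monoid_scheme \<Rightarrow> 'a topology \<Rightarrow> 'a set \<Rightarrow> bool" where
  "topologically_generates G T X \<longleftrightarrow>
     X \<subseteq> carrier G \<and> T closure_of (generate G X) = carrier G"

definition topologically_finitely_generated ::
    "('a, 'b) monoid_scheme \<Rightarrow> 'a topology \<Rightarrow> bool" where
  "topologically_finitely_generated G T \<longleftrightarrow> (\<exists>X. finite X \<and> topologically_generates G T X)"

text \<open>Minimality is with respect to inclusion; minimal generating sets may be infinite.\<close>

definition minimal_generating_set ::
    "('a, 'b) monoid_scheme \<Rightarrow> 'a topology \<Rightarrow> 'a set \<Rightarrow> bool" where
  "minimal_generating_set G T X \<longleftrightarrow>
     topologically_generates G T X \<and> (\<forall>Y. Y \<subset> X \<longrightarrow> \<not> topologically_generates G T Y)"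

definition virtually_independent ::
    "('a, 'b) monoid_scheme \<Rightarrow> 'a topology \<Rightarrow> 'a \<Rightarrow> 'a \<Rightarrow> bool" where
  "virtually_independent G T x y \<longleftrightarrow>
     (\<exists>H X. subgroup H G \<and> openin T H \<and>
        minimal_generating_set (G\<lparr>carrier := H\<rparr>) (subtopology T H) X \<and> x \<in> X \<and> y \<in> X)"

section \<open>Graphs\<close>

text \<open>
  A simple graph, possibly infinite, is represented by a loop-free symmetric digraph without
  parallel arcs: an edge is a pair of opposite arcs. For such digraphs the directed paths below
  are exactly the paths of the graph. The predicate \<open>Digraph_Component.connected\<close> is not used
  because it excludes the graph without vertices.
\<close>

definition nonisolated_subgraph :: "('a, 'b) pre_digraph \<Rightarrow> ('a, 'b) pre_digraph" where
  "nonisolated_subgraph \<Gamma> = \<Gamma> \<restriction> {v \<in> verts \<Gamma>. \<exists>w. (v, w) \<in> arcs_ends \<Gamma>}"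

definition connected_graph :: "('a, 'b) pre_digraph \<Rightarrow> bool" where
  "connected_graph \<Gamma> \<longleftrightarrow>
     (\<forall>u \<in> verts \<Gamma>. \<forall>v \<in> verts \<Gamma>. \<exists>p. pre_digraph.apath \<Gamma> u p v)"

definition graph_distance :: "('a, 'b) pre_digraph \<Rightarrow> 'a \<Rightarrow> 'a \<Rightarrow> enat" where
  "graph_distance \<Gamma> u v = (INF p \<in> {p. pre_digraph.apath \<Gamma> u p v}. enat (length p))"

definition graph_diameter :: "('a, 'b) pre_digraph \<Rightarrow> enat" where
  "graph_diameter \<Gamma> = (SUP u \<in> verts \<Gamma>. SUP v \<in> verts \<Gamma>. graph_distance \<Gamma> u v)"

definition virtual_independence_graph ::
    "('a, 'b) monoid_scheme \<Rightarrow> 'a topology \<Rightarrow> ('a, 'a \<times> 'a) pre_digraph" where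
  "virtual_independence_graph G T =
     \<lparr>verts = carrier G,
      arcs = {(x, y). x \<in> carrier G \<and> y \<in> carrier G \<and> x \<noteq> y \<and> virtually_independent G T x y},
      tail = fst,
      head = snd\<rparr>"

lemma virtually_independent_sym:
  "virtually_independent G T x y \<Longrightarrow> virtually_independent G T y x"
  unfolding virtually_independent_def by blast

lemma sym_digraph_virtual_independence_graph:
  "sym_digraph (virtual_independence_graph G T)"
  by unfold_locales
    (auto simp: virtual_independence_graph_def symmetric_def sym_def arcs_ends_def
      arc_to_ends_def image_iff intro: virtually_independent_sym)

lemma loopfree_digraph_virtual_independence_graph:
  "loopfree_digraph (virtual_independence_graph G T)"
  by unfold_locales (auto simp: virtual_independence_graph_def)

lemma nomulti_digraph_virtual_independence_graph:
  "nomulti_digraph (virtual_independence_graph G T)"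
  by unfold_locales (auto simp: virtual_independence_graph_def arc_to_ends_def)

definition nonisolated_virtual_independence_graph ::
    "('a, 'b) monoid_scheme \<Rightarrow> 'a topology \<Rightarrow> ('a, 'a \<times> 'a) pre_digraph" where
  "nonisolated_virtual_independence_graph G T =
     nonisolated_subgraph (virtual_independence_graph G T)"

end

(*
Write x <= y if x lies in the closed subgroup <y> generated by y.  Two distinct elements are
virtually independent iff they are incomparable: if they are, choose open subgroups U and V that
contain <x> and <y> and avoid y and x respectively; the open subgroup <x, y, U \<inter> V> is
generated by x, y and finitely many elements of U \<inter> V, and x and y cannot be dropped.

Let x <= y, with a incomparable to x and b incomparable to y.  If there is no path through a and b
alone, then x and a both lie in <y> and in <b>.  In the procyclic group <b> one can factor
b = b1 b2 with a not in <b1> and x not in <b2>.  Since b is not in <y>, one of b1, b2 is not in <y>,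
which gives the path x - a - b1 - y or the path x - b2 - y.
*)

theory Submission
  imports Defs "HOL-Computational_Algebra.Primes"
begin

no_notation eq_closure_of (\<open>closure'_of\<index>\<close>)

section \<open>Divisibility in the integers\<close>

lemma int_subgroup_eq_multiples:
  fixes S :: "int set"
  assumes "0 \<in> S" and diff: "\<And>m n. m \<in> S \<Longrightarrow> n \<in> S \<Longrightarrow> m - n \<in> S"
  obtains d where "\<And>m. m \<in> S \<longleftrightarrow> d dvd m"
proof (cases "S = {0}")
  case True
  then show ?thesis using that[of 0] by auto
next
  case False
  have neg: "- m \<in> S" if "m \<in> S" for m
    using diff[OF \<open>0 \<in> S\<close> that] by simp
  have add: "m + n \<in> S" if "m \<in> S" "n \<in> S" for m n
    using diff[OF that(1) neg[OF that(2)]] by simp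
  obtain m where "m \<in> S" "m \<noteq> 0" using False \<open>0 \<in> S\<close> by auto
  then have "\<exists>k::nat. k > 0 \<and> int k \<in> S"
    using neg[of m] by (intro exI[of _ "nat \<bar>m\<bar>"]) (auto simp: abs_if)
  then obtain k :: nat where k: "k > 0" "int k \<in> S"
    and least: "\<And>j::nat. j < k \<Longrightarrow> \<not> (j > 0 \<and> int j \<in> S)"
    using exists_least_iff[of "\<lambda>k::nat. k > 0 \<and> int k \<in> S"] by blast
  have pos: "int j * int k \<in> S" for j
    by (induction j) (auto simp: \<open>0 \<in> S\<close> distrib_right intro: add k)
  have mult: "q * int k \<in> S" for q
    using pos[of "nat \<bar>q\<bar>"] neg[OF pos[of "nat \<bar>q\<bar>"]] by (cases "q \<ge> 0") auto
  have "int k dvd m" if "m \<in> S" for m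
  proof -
    define r where "r = nat (m mod int k)"
    have r: "int r = m mod int k" "r < k" using k by (auto simp: r_def nat_less_iff)
    have "int r \<in> S"
      using diff[OF that mult[of "m div int k"]] r by (simp add: minus_div_mult_eq_mod)
    then have "r = 0" using least[OF r(2)] by auto
    then have "m mod int k = 0" using r by simp
    then show ?thesis by auto
  qed
  moreover have "m \<in> S" if "int k dvd m" for m
    using that mult by (auto simp: dvd_def mult.commute)
  ultimately show ?thesis using that by blast
qed

text \<open>Some prime has larger multiplicity in \<open>s\<close> than in \<open>i\<close>, since
  otherwise \<open>s\<close> would divide \<open>i\<close>; its full power in \<open>s\<close> is
  the witness.\<close>

lemma prime_power_dvd_not_dvd:
  fixes s i :: int
  assumes "\<not> s dvd i" and "s \<noteq> 0"
  obtains p k where "prime p" "p ^ k dvd s" "\<not> p ^ k dvd i"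
proof -
  have "i \<noteq> 0" using assms by auto
  obtain p where p: "prime p" "multiplicity p i < multiplicity p s"
  proof (rule ccontr)
    assume "\<not> thesis"
    then have "s dvd i"
      using that by (intro multiplicity_le_imp_dvd[OF assms(2)]) (meson not_le)
    then show False using assms(1) by simp
  qed
  have "\<not> p ^ multiplicity p s dvd i"
    using p \<open>i \<noteq> 0\<close> by (subst power_dvd_iff_le_multiplicity) auto
  then show ?thesis using that[of p "multiplicity p s"] p multiplicity_dvd by blast
qed

lemma coprime_divisors_not_dvd:
  fixes s t i j :: int
  assumes "s dvd j" "\<not> s dvd i" "t dvd i" "\<not> t dvd j"
  obtains \<alpha> \<beta> where "\<alpha> dvd s" "\<beta> dvd t" "\<not> \<alpha> dvd i" "\<not> \<beta> dvd j" "coprime \<alpha> \<beta>"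
proof -
  \<comment> \<open>If \<open>s = 0\<close> then \<open>j = 0\<close>, which \<open>t\<close>
    divides; if \<open>t = 0\<close> then \<open>i = 0\<close>, which \<open>s\<close>
    divides.\<close>
  have "s \<noteq> 0" "t \<noteq> 0" using assms by (metis dvd_0_left_iff dvd_0_right)+
  obtain p k where pk: "prime p" "p ^ k dvd s" "\<not> p ^ k dvd i"
    using prime_power_dvd_not_dvd[OF assms(2) \<open>s \<noteq> 0\<close>] .
  obtain q l where ql: "prime q" "q ^ l dvd t" "\<not> q ^ l dvd j"
    using prime_power_dvd_not_dvd[OF assms(4) \<open>t \<noteq> 0\<close>] .
  \<comment> \<open>For equal primes the smaller of the two powers divides the larger one, hence
    divides both \<open>s\<close> and \<open>t\<close>, and so both \<open>i\<close> and
    \<open>j\<close>.\<close>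
  have "p \<noteq> q"
  proof
    assume "p = q"
    then have "\<not> k \<le> l" "\<not> l \<le> k"
      using pk ql assms(1,3) by (metis dvd_trans le_imp_power_dvd)+
    then show False by simp
  qed
  then have "coprime (p ^ k) (q ^ l)"
    using primes_coprime[OF pk(1) ql(1)] by simp
  then show ?thesis using that pk ql by blast
qed

lemma finite_minimal_subset:
  assumes "finite Z" "P Z"
  shows "\<exists>Y \<subseteq> Z. P Y \<and> (\<forall>W. W \<subset> Y \<longrightarrow> \<not> P W)"
  using assms
proof (induction rule: finite_psubset_induct)
  case (psubset Z)
  show ?case
  proof (cases "\<exists>W. W \<subset> Z \<and> P W")
    case True
    then obtain W where "W \<subset> Z" "P W" by (elim exE conjE)
    from psubset.IH[OF this] show ?thesis using \<open>W \<subset> Z\<close> by (meson order_trans psubset_imp_subset)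
  qed (use psubset.prems in blast)
qed

section \<open>Closed subgroups of topological groups\<close>

context topological_group
begin

lemma continuous_map_mult_left:
  assumes "g \<in> carrier G"
  shows "continuous_map T T (\<lambda>x. g \<otimes> x)"
proof -
  have "continuous_map T (prod_topology T T) (\<lambda>x. (g, x))"
    using assms by (intro continuous_map_pairedI) (auto simp: topspace_eq_carrier)
  from continuous_map_compose[OF this continuous_mult] show ?thesis
    by (simp add: o_def)
qed

lemma continuous_map_mult_right:
  assumes "g \<in> carrier G"
  shows "continuous_map T T (\<lambda>x. x \<otimes> g)"
proof -
  have "continuous_map T (prod_topology T T) (\<lambda>x. (x, g))"
    using assms by (intro continuous_map_pairedI) (auto simp: topspace_eq_carrier)
  from continuous_map_compose[OF this continuous_mult] show ?thesis
    by (simp add: o_def)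
qed

lemma openin_mult_left_preimage:
  assumes "openin T W" "g \<in> carrier G"
  shows "openin T {x \<in> carrier G. g \<otimes> x \<in> W}"
  using openin_continuous_map_preimage[OF continuous_map_mult_left assms(1)] assms(2)
  by (simp add: topspace_eq_carrier)

lemma openin_mult_right_preimage:
  assumes "openin T W" "g \<in> carrier G"
  shows "openin T {x \<in> carrier G. x \<otimes> g \<in> W}"
  using openin_continuous_map_preimage[OF continuous_map_mult_right assms(1)] assms(2)
  by (simp add: topspace_eq_carrier)

lemma subgroup_closure_of:
  assumes "subgroup K G"
  shows "subgroup (T closure_of K) G"
proof -
  interpret K: subgroup K G by fact
  have K: "K \<subseteq> topspace T" by (simp add: topspace_eq_carrier K.subset)
  show ?thesis
  proof
    show "T closure_of K \<subseteq> carrier G"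
      by (simp add: closure_of_subset_topspace flip: topspace_eq_carrier)
    show "\<one> \<in> T closure_of K"
      using closure_of_subset[OF K] K.one_closed by (rule subsetD)
  next
    fix x y assume "x \<in> T closure_of K" "y \<in> T closure_of K"
    then have "(x, y) \<in> prod_topology T T closure_of (K \<times> K)"
      by (simp add: closure_of_Times)
    then have "x \<otimes> y \<in> (\<lambda>(x, y). x \<otimes> y) ` (prod_topology T T closure_of (K \<times> K))"
      by (intro image_eqI[of _ _ "(x, y)"]) simp
    also have "\<dots> \<subseteq> T closure_of ((\<lambda>(x, y). x \<otimes> y) ` (K \<times> K))"
      by (rule continuous_map_image_closure_subset[OF continuous_mult])
    also have "\<dots> \<subseteq> T closure_of K" by (intro closure_of_mono) auto
    finally show "x \<otimes> y \<in> T closure_of K" .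
  next
    fix x assume "x \<in> T closure_of K"
    then have "inv x \<in> (\<lambda>x. inv x) ` (T closure_of K)" by blast
    also have "\<dots> \<subseteq> T closure_of ((\<lambda>x. inv x) ` K)"
      by (rule continuous_map_image_closure_subset[OF continuous_inv])
    also have "\<dots> \<subseteq> T closure_of K" by (intro closure_of_mono) auto
    finally show "inv x \<in> T closure_of K" .
  qed
qed

text \<open>For every \<open>x\<close> in \<open>U\<close>, the translate \<open>xW\<close> is an
  open neighbourhood of \<open>x\<close> inside \<open>U\<close>.\<close>

lemma openin_subgroupI:
  assumes "subgroup U G" "openin T W" "\<one> \<in> W" "W \<subseteq> U"
  shows "openin T U"
proof (subst openin_subopen, intro ballI)
  fix x assume x: "x \<in> U"
  interpret U: subgroup U G by fact
  have xc: "x \<in> carrier G" using x by auto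
  have "openin T {g \<in> carrier G. inv x \<otimes> g \<in> W}"
    using xc by (intro openin_mult_left_preimage assms) auto
  moreover have "x \<in> {g \<in> carrier G. inv x \<otimes> g \<in> W}" using xc assms by simp
  moreover have "{g \<in> carrier G. inv x \<otimes> g \<in> W} \<subseteq> U"
  proof safe
    fix g assume g: "g \<in> carrier G" "inv x \<otimes> g \<in> W"
    then have "x \<otimes> (inv x \<otimes> g) \<in> U" using assms x by blast
    then show "g \<in> U" using g xc by (simp add: m_assoc[symmetric])
  qed
  ultimately show "\<exists>V. openin T V \<and> x \<in> V \<and> V \<subseteq> U" by blast
qed

text \<open>The coset \<open>sU\<close> is an open neighbourhood of \<open>s\<close> and therefore
  meets \<open>S\<close>. This is how limit points are replaced by honest elements of
  \<open>S\<close> modulo an open subgroup.\<close>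

lemma closure_of_open_subgroupE:
  assumes "subgroup U G" "openin T U" "S \<subseteq> carrier G" "s \<in> T closure_of S"
  obtains g where "g \<in> S" "inv g \<otimes> s \<in> U"
proof -
  interpret U: subgroup U G by fact
  have s: "s \<in> carrier G" using assms(4) by (auto simp: in_closure_of topspace_eq_carrier)
  let ?V = "{g \<in> carrier G. inv s \<otimes> g \<in> U}"
  have "openin T ?V" using s assms by (intro openin_mult_left_preimage) auto
  moreover have "s \<in> ?V" using s by simp
  ultimately have "\<exists>g. g \<in> S \<and> g \<in> ?V"
    using assms(4) unfolding in_closure_of by (elim conjE) (drule spec[of _ ?V], simp)
  then obtain g where g: "g \<in> S" "inv s \<otimes> g \<in> U" by auto
  have "inv (inv s \<otimes> g) = inv g \<otimes> s"
    using s g assms(3) by (auto simp: inv_mult_group)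
  then show ?thesis using that[OF g(1)] U.m_inv_closed[OF g(2)] by simp
qed

lemma closedin_open_subgroup:
  assumes "subgroup U G" "openin T U"
  shows "closedin T U"
proof -
  interpret U: subgroup U G by fact
  have "T closure_of U \<subseteq> U"
  proof
    fix s assume s: "s \<in> T closure_of U"
    then obtain g where g: "g \<in> U" "inv g \<otimes> s \<in> U"
      using closure_of_open_subgroupE[OF assms U.subset] by metis
    have sc: "s \<in> carrier G" using s by (auto simp: in_closure_of topspace_eq_carrier)
    have "g \<otimes> (inv g \<otimes> s) \<in> U" using g by blast
    then show "s \<in> U" using g sc by (simp add: m_assoc[symmetric])
  qed
  then show ?thesis
    by (simp add: closure_of_subset_eq[symmetric] topspace_eq_carrier U.subset)
qed

section \<open>Closed subgroups generated by a set\<close>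

definition closed_span :: "'a set \<Rightarrow> 'a set" where
  "closed_span X = T closure_of generate G X"

lemma subgroup_closed_span: "X \<subseteq> carrier G \<Longrightarrow> subgroup (closed_span X) G"
  unfolding closed_span_def by (intro subgroup_closure_of generate_is_subgroup)

lemma closedin_closed_span: "closedin T (closed_span X)"
  by (simp add: closed_span_def)

lemma closed_span_superset: 
  assumes "X \<subseteq> carrier G" shows "X \<subseteq> closed_span X"
proof -
  have "X \<subseteq> generate G X" by (auto intro: generate.incl)
  also have "\<dots> \<subseteq> closed_span X" unfolding closed_span_def
    using generate_incl[OF assms] by (intro closure_of_subset) (simp add: topspace_eq_carrier)
  finally show ?thesis .
qed

lemma closed_span_minimal:
  assumes "X \<subseteq> K" "subgroup K G" "closedin T K"
  shows "closed_span X \<subseteq> K"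
  unfolding closed_span_def
  using generate_subgroup_incl[OF assms(1,2)] assms(3) by (rule closure_of_minimal)

lemma closed_span_subset_closed_span:
  "X \<subseteq> closed_span Y \<Longrightarrow> Y \<subseteq> carrier G \<Longrightarrow> closed_span X \<subseteq> closed_span Y"
  by (intro closed_span_minimal subgroup_closed_span closedin_closed_span)

lemma closed_span_mono: 
  assumes "X \<subseteq> Y" "Y \<subseteq> carrier G" shows "closed_span X \<subseteq> closed_span Y"
  using closed_span_subset_closed_span closed_span_superset assms by blast

text \<open>An open subgroup is closed, so the closure in \<open>H\<close> of a subset of
  \<open>H\<close> is its closure in \<open>G\<close>. All generation statements can then be made
  inside \<open>G\<close>.\<close>

lemma topologically_generates_open_subgroup_iff:
  assumes "subgroup H G" "openin T H"
  shows "topologically_generates (G\<lparr>carrier := H\<rparr>) (subtopology T H) X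
    \<longleftrightarrow> X \<subseteq> H \<and> closed_span X = H"
proof (cases "X \<subseteq> H")
  case True
  have "closed_span X \<subseteq> H"
    using closed_span_minimal[OF True] assms closedin_open_subgroup by blast
  moreover have "H \<inter> generate G X = generate G X"
    using generate_subgroup_incl[OF True assms(1)] by blast
  ultimately show ?thesis
    using True generate_consistent[OF True assms(1)]
    by (auto simp: topologically_generates_def closure_of_subtopology closed_span_def)
qed (auto simp: topologically_generates_def)

text \<open>Otherwise \<open>x\<close> would be redundant: \<open>X - {x}\<close> still contains
  \<open>y\<close>, so its closed span contains \<open>x\<close> and hence all of
  \<open>X\<close>.\<close>

lemma minimal_generating_set_not_in_closed_span:
  assumes H: "subgroup H G" "openin T H"
    and X: "minimal_generating_set (G\<lparr>carrier := H\<rparr>) (subtopology T H) X"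
    and xy: "x \<in> X" "y \<in> X" "x \<noteq> y"
  shows "x \<notin> closed_span {y}"
proof
  assume x: "x \<in> closed_span {y}"
  note gen = topologically_generates_open_subgroup_iff[OF H]
  have "X \<subseteq> H" and span: "closed_span X = H"
    using X by (auto simp: minimal_generating_set_def gen)
  then have Xc: "X \<subseteq> carrier G" using subgroup.subset[OF H(1)] by blast
  have "closed_span {y} \<subseteq> closed_span (X - {x})"
    using xy Xc by (intro closed_span_mono) auto
  then have "X \<subseteq> closed_span (X - {x})"
    using x closed_span_superset[of "X - {x}"] Xc by blast
  then have "H \<subseteq> closed_span (X - {x})"
    using closed_span_subset_closed_span[of X "X - {x}"] Xc span by blast
  moreover have "closed_span (X - {x}) \<subseteq> H"
    using closed_span_mono[of "X - {x}" X] Xc span by blast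
  ultimately have "topologically_generates (G\<lparr>carrier := H\<rparr>) (subtopology T H) (X - {x})"
    using \<open>X \<subseteq> H\<close> by (subst gen) auto
  moreover have "X - {x} \<subset> X" using xy by blast
  ultimately show False using X unfolding minimal_generating_set_def by blast
qed

section \<open>Procyclic subgroups modulo open subgroups\<close>

lemma int_pow_subgroup_eq_multiples:
  assumes "subgroup U G" "b \<in> carrier G"
  obtains d :: int where "\<And>m. b [^] m \<in> U \<longleftrightarrow> d dvd m"
proof -
  interpret U: subgroup U G by fact
  have "b [^] (m - n) \<in> U" if "b [^] m \<in> U" "b [^] n \<in> U" for m n :: int
    unfolding int_pow_diff[OF assms(2)] using that by (intro U.m_closed U.m_inv_closed)
  then obtain d where "\<And>m. m \<in> {m::int. b [^] m \<in> U} \<longleftrightarrow> d dvd m"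
    using int_subgroup_eq_multiples[of "{m::int. b [^] m \<in> U}"] U.one_closed by auto
  then show ?thesis by (intro that[of d]) simp
qed

text \<open>Modulo an open subgroup, every element of the procyclic group <b> is an integer power of
  \<open>b\<close>, so integers can stand in for profinite exponents.\<close>

lemma closed_span_singletonE:
  assumes "subgroup U G" "openin T U" "b \<in> carrier G" "x \<in> closed_span {b}"
  obtains n :: int where "inv (b [^] n) \<otimes> x \<in> U"
proof -
  have "generate G {b} \<subseteq> carrier G" using assms(3) by (intro generate_incl) auto
  then obtain g where "g \<in> generate G {b}" "inv g \<otimes> x \<in> U"
    using closure_of_open_subgroupE[OF assms(1,2)] assms(4) unfolding closed_span_def by metis
  then show ?thesis using that generate_pow[OF assms(3)] by auto
qed

lemma (in group) subgroup_inv_mult_mem_iff: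
  assumes "subgroup U G" "g \<in> carrier G" "x \<in> carrier G" "inv g \<otimes> x \<in> U"
  shows "g \<in> U \<longleftrightarrow> x \<in> U"
proof -
  interpret U: subgroup U G by fact
  have x: "x = g \<otimes> (inv g \<otimes> x)" using assms by (simp add: m_assoc[symmetric])
  have g: "g = x \<otimes> inv (inv g \<otimes> x)"
    using assms by (simp add: inv_mult_group m_assoc[symmetric])
  show ?thesis using assms(4) x g by (metis U.m_closed U.m_inv_closed)
qed

text \<open>The exponents of \<open>b\<close> come from Bezout coefficients of two coprime prime powers
  detecting, modulo open subgroups, that \<open>a\<close> and \<open>x\<close> are incomparable.\<close>

lemma procyclic_split:
  assumes b: "b \<in> carrier G" and a: "a \<in> closed_span {b}" and x: "x \<in> closed_span {b}"
    and U: "subgroup U G" "openin T U" "x \<in> U" "a \<notin> U"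
    and V: "subgroup V G" "openin T V" "a \<in> V" "x \<notin> V"
  obtains b1 b2 where "b1 \<in> closed_span {b}" "b2 \<in> closed_span {b}" "b = b1 \<otimes> b2"
    "a \<notin> closed_span {b1}" "x \<notin> closed_span {b2}"
proof -
  \<comment> \<open>Approximating modulo the intersection makes the same exponents \<open>i\<close>
    and \<open>j\<close> valid modulo both \<open>U\<close> and \<open>V\<close>.\<close>
  let ?N = "U \<inter> V"
  have N: "subgroup ?N G" "openin T ?N"
    using U V by (auto intro: subgroups_Inter_pair)
  have ac: "a \<in> carrier G" and xc: "x \<in> carrier G"
    using U V by (auto dest: subgroup.subset)
  obtain i :: int where i: "inv (b [^] i) \<otimes> a \<in> ?N"
    using closed_span_singletonE[OF N b a] by blast
  obtain j :: int where j: "inv (b [^] j) \<otimes> x \<in> ?N"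
    using closed_span_singletonE[OF N b x] by blast
  obtain s where s: "\<And>m::int. b [^] m \<in> U \<longleftrightarrow> s dvd m"
    using int_pow_subgroup_eq_multiples[OF U(1) b] by blast
  obtain t where t: "\<And>m::int. b [^] m \<in> V \<longleftrightarrow> t dvd m"
    using int_pow_subgroup_eq_multiples[OF V(1) b] by blast
  \<comment> \<open>Membership of \<open>a\<close> and \<open>x\<close> in \<open>U\<close> and
    \<open>V\<close>, read off from the exponents: \<open>a\<close> behaves like
    \<open>b [^] i\<close> and \<open>x\<close> like \<open>b [^] j\<close>.\<close>
  have "s dvd j" "\<not> s dvd i" "t dvd i" "\<not> t dvd j"
    using subgroup_inv_mult_mem_iff[OF U(1), of "b [^] i" a]
      subgroup_inv_mult_mem_iff[OF U(1), of "b [^] j" x]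
      subgroup_inv_mult_mem_iff[OF V(1), of "b [^] i" a]
      subgroup_inv_mult_mem_iff[OF V(1), of "b [^] j" x]
      i j U V b ac xc by (auto simp: s[symmetric] t[symmetric])
  then obtain \<alpha> \<beta> where ab: "\<alpha> dvd s" "\<beta> dvd t" "\<not> \<alpha> dvd i" "\<not> \<beta> dvd j" "coprime \<alpha> \<beta>"
    by (rule coprime_divisors_not_dvd)
  obtain u v where uv: "u * \<alpha> + v * \<beta> = 1"
    using bezout_int[of \<alpha> \<beta>] ab(5) by (metis coprime_imp_gcd_eq_1)
  let ?b1 = "b [^] (u * \<alpha>)" and ?b2 = "b [^] (v * \<beta>)"
  \<comment> \<open>If \<open>c\<close> were in this closed span, then modulo \<open>W\<close> it
    would agree both with \<open>b [^] k\<close> and with some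
    \<open>b [^] (w * \<gamma> * n)\<close>. Hence \<open>r\<close> would divide the difference of
    these exponents, and its divisor \<gamma> would divide \<open>k\<close>.\<close>
  have key: "c \<notin> closed_span {b [^] (w * \<gamma>)}"
    if W: "subgroup W G" "openin T W" and r: "\<And>m::int. b [^] m \<in> W \<longleftrightarrow> r dvd m" "\<gamma> dvd r"
      and k: "\<not> \<gamma> dvd k" and c: "inv (b [^] k) \<otimes> c \<in> W" "c \<in> carrier G" for W r \<gamma> k c w
  proof
    assume "c \<in> closed_span {b [^] (w * \<gamma>)}"
    then obtain n :: int where n: "inv ((b [^] (w * \<gamma>)) [^] n) \<otimes> c \<in> W"
      using closed_span_singletonE[OF W, of "b [^] (w * \<gamma>)" c] b by auto
    interpret W: subgroup W G by fact
    have pow: "(b [^] (w * \<gamma>)) [^] n = b [^] (w * \<gamma> * n)"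
      using b by (simp add: int_pow_pow)
    have cancel: "c \<otimes> (inv c \<otimes> z) = z" if "z \<in> carrier G" for z
      using c that by (simp add: m_assoc[symmetric])
    have "inv (b [^] k) \<otimes> c \<otimes> inv (inv (b [^] (w * \<gamma> * n)) \<otimes> c) \<in> W"
      using n c pow by auto
    also have "inv (b [^] k) \<otimes> c \<otimes> inv (inv (b [^] (w * \<gamma> * n)) \<otimes> c)
        = inv (b [^] k) \<otimes> b [^] (w * \<gamma> * n)"
      using b c by (simp add: inv_mult_group m_assoc cancel)
    also have "\<dots> = b [^] (- k + w * \<gamma> * n)"
      using b by (simp only: int_pow_mult int_pow_neg)
    finally have "\<gamma> dvd - k + w * \<gamma> * n" using r dvd_trans by blast
    then have "\<gamma> dvd k" by (metis dvd_add_left_iff dvd_minus_iff dvd_mult dvd_mult2 dvd_refl)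
    then show False using k by blast
  qed
  have mem: "b [^] k \<in> closed_span {b}" for k :: int
    using closed_span_superset[of "{b}"] subgroup_closed_span[of "{b}"] b
    by (intro subgroup_int_pow_closed) auto
  show ?thesis
  proof
    show "?b1 \<in> closed_span {b}" "?b2 \<in> closed_span {b}" by (rule mem)+
    show "b = ?b1 \<otimes> ?b2" using b uv by (simp add: int_pow_mult[symmetric])
    show "a \<notin> closed_span {?b1}" using key[OF U(1,2) s ab(1,3), of a] i ac by blast
    show "x \<notin> closed_span {?b2}" using key[OF V(1,2) t ab(2,4), of x] j xc by blast
  qed
qed

end

section \<open>Open subgroups of profinite groups\<close>

context profinite_group
begin

text \<open>A form of the tube lemma: the complement is the projection of a closed subset of the
  product along a compact factor, hence closed.\<close>

lemma openin_forall_in_closed: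
  assumes f: "continuous_map (prod_topology T T) T f" and C: "closedin T C" and W: "openin T W"
  shows "openin T {g \<in> carrier G. \<forall>c\<in>C. f (g, c) \<in> W}"
proof -
  let ?B = "{p \<in> topspace (prod_topology T T). f p \<in> topspace T - W} \<inter> (topspace T \<times> C)"
  have "closedin (prod_topology T T) ?B"
    using W C by (intro closedin_Int closedin_continuous_map_preimage[OF f])
      (auto simp: closedin_prod_Times_iff)
  then have "closedin T (fst ` ?B)"
    using closed_map_fst[OF compact] by (auto simp: closed_map_def)
  moreover have "{g \<in> carrier G. \<forall>c\<in>C. f (g, c) \<in> W} = topspace T - fst ` ?B"
  proof -
    have "f (g, c) \<in> topspace T" if "g \<in> carrier G" "c \<in> C" for g c
      using continuous_map_image_subset_topspace[OF f] that closedin_subset[OF C]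
      by (auto simp: topspace_eq_carrier image_subset_iff)
    moreover have "C \<subseteq> carrier G"
      using closedin_subset[OF C] by (simp add: topspace_eq_carrier)
    ultimately have "g \<in> fst ` ?B \<longleftrightarrow> g \<in> carrier G \<and> (\<exists>c\<in>C. f (g, c) \<notin> W)" for g
      unfolding image_iff Bex_def by (simp add: topspace_eq_carrier) blast
    then show ?thesis by (auto simp: topspace_eq_carrier)
  qed
  ultimately show ?thesis by auto
qed

text \<open>A clopen set between \<open>C\<close> and the complement of \<open>y\<close> is shrunk
  in two steps to an open subgroup: first to a set stable under right multiplication by
  \<open>C\<close>, then to the right stabiliser of that set.\<close>

lemma closed_subgroup_separation:
  assumes C: "subgroup C G" "closedin T C" and y: "y \<in> carrier G" "y \<notin> C"
  obtains U where "subgroup U G" "openin T U" "C \<subseteq> U" "y \<notin> U"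
proof -
  interpret C: subgroup C G by fact
  have "separated_between T C {y}"
  proof (rule cut_wire_fence_theorem[OF compact Hausdorff C(2)])
    show "closedin T {y}"
      using y Hausdorff by (simp add: topspace_eq_carrier closedin_Hausdorff_sing_eq)
    show "disjnt S C \<or> disjnt S {y}" if S: "connectedin T S" for S
    proof -
      obtain z where "S \<subseteq> {z}"
        using totally_disconnected S unfolding totally_disconnected_space_def by blast
      then show ?thesis using y by (auto simp: disjnt_def)
    qed
  qed
  then obtain K where K: "closedin T K" "openin T K" "C \<subseteq> K" "y \<notin> K"
    unfolding separated_between by auto
  \<comment> \<open>\<open>L\<close> is open by the tube argument over \<open>C\<close>, and closed
    as an intersection of preimages of the closed set \<open>K\<close>. Both are used below: to
    stabilise \<open>L\<close>, the tube argument needs it as closed parameter set and as open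
    target.\<close>
  define L where "L = {g \<in> carrier G. \<forall>c\<in>C. g \<otimes> c \<in> K}"
  have "openin T L"
    using openin_forall_in_closed[OF continuous_mult C(2) K(2)] by (simp add: L_def)
  have "closedin T L"
  proof -
    have "C \<noteq> {}" using C.one_closed by blast
    have "closedin T (\<Inter>c\<in>C. {g \<in> topspace T. g \<otimes> c \<in> K})"
      using \<open>C \<noteq> {}\<close> K(1)
      by (intro closedin_INT closedin_continuous_map_preimage[OF continuous_map_mult_right]) auto
    moreover have "L = (\<Inter>c\<in>C. {g \<in> topspace T. g \<otimes> c \<in> K})"
      using \<open>C \<noteq> {}\<close> by (auto simp: L_def topspace_eq_carrier)
    ultimately show ?thesis by simp
  qed
  \<comment> \<open>\<open>M\<close> is an open submonoid. It contains \<open>C\<close> because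
    \<open>L\<close> is stable under right multiplication by \<open>C\<close>.\<close>
  define M where "M = {g \<in> carrier G. \<forall>k\<in>L. k \<otimes> g \<in> L}"
  have "continuous_map (prod_topology T T) T ((\<lambda>(x, y). x \<otimes> y) \<circ> (\<lambda>p. (snd p, fst p)))"
    by (intro continuous_map_compose[OF _ continuous_mult] continuous_map_pairedI
        continuous_map_fst continuous_map_snd)
  then have "continuous_map (prod_topology T T) T (\<lambda>(g, k). k \<otimes> g)"
    by (simp add: o_def case_prod_beta')
  from openin_forall_in_closed[OF this \<open>closedin T L\<close> \<open>openin T L\<close>]
  have "openin T M" by (simp add: M_def)
  define U where "U = {g \<in> M. inv g \<in> M}"
  have "openin T {g \<in> topspace T. inv g \<in> M}"
    by (rule openin_continuous_map_preimage[OF continuous_inv \<open>openin T M\<close>])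
  moreover have "U = M \<inter> {g \<in> topspace T. inv g \<in> M}"
    by (auto simp: U_def M_def topspace_eq_carrier)
  ultimately have "openin T U" using \<open>openin T M\<close> by auto
  have Lc: "L \<subseteq> carrier G" by (auto simp: L_def)
  have M_mult: "g \<otimes> h \<in> M" if "g \<in> M" "h \<in> M" for g h
    using that Lc by (auto simp: M_def subset_iff m_assoc[symmetric])
  have "\<one> \<in> M" using Lc by (auto simp: M_def subset_iff)
  have "subgroup U G"
  proof
    show "U \<subseteq> carrier G" by (auto simp: U_def M_def)
    show "\<one> \<in> U" using \<open>\<one> \<in> M\<close> by (simp add: U_def)
    show "inv g \<in> U" if "g \<in> U" for g using that by (auto simp: U_def M_def)
    show "g \<otimes> h \<in> U" if "g \<in> U" "h \<in> U" for g h
    proof -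
      have "inv (g \<otimes> h) = inv h \<otimes> inv g"
        using that by (intro inv_mult_group) (auto simp: U_def M_def)
      then show ?thesis using that M_mult by (auto simp: U_def)
    qed
  qed
  have "c \<in> M" if "c \<in> C" for c
    using that by (auto simp: M_def L_def m_assoc)
  then have "C \<subseteq> U" by (auto simp: U_def)
  have "\<one> \<in> L" using K(3) by (auto simp: L_def)
  \<comment> \<open>Applying an element of \<open>U\<close> to \<one>, which lies in
    \<open>L\<close>, shows that \<open>U\<close> is contained in \<open>L\<close>, and
    \<open>L\<close> is contained in \<open>K\<close> because \<one> is in \<open>C\<close>.\<close>
  have "y \<notin> U"
  proof
    assume "y \<in> U"
    then have "y \<in> L" using \<open>\<one> \<in> L\<close> y by (force simp: U_def M_def)
    then have "y \<otimes> \<one> \<in> K" using C.one_closed unfolding L_def by blast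
    then show False using K y by simp
  qed
  show ?thesis by (rule that) fact+
qed

section \<open>Finite generation of open subgroups\<close>

text \<open>The right cosets \<open>Nr\<close> form an open cover, and compactness leaves finitely
  many. A coset may be represented more than once in \<open>R\<close>.\<close>

lemma open_subgroup_finite_transversal:
  assumes N: "subgroup N G" "openin T N"
  obtains R where "finite R" "R \<subseteq> carrier G" "\<And>g. g \<in> carrier G \<Longrightarrow> \<exists>r\<in>R. g \<otimes> inv r \<in> N"
proof -
  interpret N: subgroup N G by fact
  let ?D = "\<lambda>r. {g \<in> carrier G. g \<otimes> inv r \<in> N}"
  have "\<forall>U \<in> ?D ` carrier G. openin T U"
    using N(2) by (auto intro: openin_mult_right_preimage)
  moreover have "\<Union>(?D ` carrier G) = topspace T"
    by (auto simp: topspace_eq_carrier intro!: bexI)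
  ultimately have "\<exists>F. finite F \<and> F \<subseteq> ?D ` carrier G \<and> \<Union>F = topspace T"
    using compact unfolding compact_space by simp
  then obtain F where F: "finite F" "F \<subseteq> ?D ` carrier G" "\<Union>F = topspace T"
    by (elim exE conjE)
  obtain R where R: "R \<subseteq> carrier G" "finite R" "F = ?D ` R"
    using finite_subset_image[OF F(1,2)] by (elim exE conjE)
  show ?thesis
    using F(3) R(3) by (intro that[OF R(2,1)]) (auto simp: topspace_eq_carrier)
qed

text \<open>Schreier's lemma, with the transversal \<open>R\<close> enlarged by \<open>\<one>\<close>.\<close>

lemma open_subgroup_topologically_finitely_generated:
  assumes fg: "topologically_finitely_generated G T" and N: "subgroup N G" "openin T N"
  obtains Z where "finite Z" "Z \<subseteq> N" "N \<subseteq> closed_span Z"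
proof -
  interpret N: subgroup N G by fact
  obtain S where S: "finite S" "S \<subseteq> carrier G" "T closure_of generate G S = carrier G"
    using fg by (auto simp: topologically_finitely_generated_def topologically_generates_def)
  obtain R0 where R0: "finite R0" "R0 \<subseteq> carrier G"
      "\<And>g. g \<in> carrier G \<Longrightarrow> \<exists>r\<in>R0. g \<otimes> inv r \<in> N"
    using open_subgroup_finite_transversal[OF N] by blast
  define R where "R = insert \<one> R0"
  have R: "finite R" "R \<subseteq> carrier G" "\<one> \<in> R"
      "\<And>g. g \<in> carrier G \<Longrightarrow> \<exists>r\<in>R. g \<otimes> inv r \<in> N"
    using R0 by (auto simp: R_def)
  define S' where "S' = S \<union> m_inv G ` S"
  have S': "finite S'" "S' \<subseteq> carrier G" using S by (auto simp: S'_def)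
  \<comment> \<open>Besides the Schreier generators, \<open>Z\<close> takes in the representatives
    lying in \<open>N\<close>: \<open>R\<close> need not meet \<open>N\<close> in \<one>
    alone.\<close>
  define Z where "Z = N \<inter> (R \<union> (\<lambda>(r, s, r'). r \<otimes> s \<otimes> inv r') ` (R \<times> S' \<times> R))"
  let ?P = "generate G Z"
  have Z: "finite Z" "Z \<subseteq> N" using R S' by (auto simp: Z_def)
  then have Zc: "Z \<subseteq> carrier G" by auto
  interpret P: subgroup ?P G by (rule generate_is_subgroup[OF Zc])
  \<comment> \<open>\<open>Q\<close> is the product \<open>?P R\<close>. It contains \<one> and is
    stable under right multiplication by \<open>S'\<close>, so it contains
    \<open>generate G S\<close>.\<close>
  define Q where "Q = {p \<otimes> r |p r. p \<in> ?P \<and> r \<in> R}"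
  have step: "q \<otimes> s \<in> Q" if q: "q \<in> Q" and s: "s \<in> S'" for q s
  proof -
    obtain p r where pr: "q = p \<otimes> r" "p \<in> ?P" "r \<in> R" using q by (auto simp: Q_def)
    have c: "p \<in> carrier G" "r \<in> carrier G" "s \<in> carrier G"
      using pr s R S' by auto
    obtain r' where r': "r' \<in> R" "r \<otimes> s \<otimes> inv r' \<in> N"
      using R(4)[of "r \<otimes> s"] c by auto
    have r'c: "r' \<in> carrier G" using r' R by auto
    have "r \<otimes> s \<otimes> inv r' \<in> (\<lambda>(r, s, r'). r \<otimes> s \<otimes> inv r') ` (R \<times> S' \<times> R)"
      using r' pr s by (intro image_eqI[of _ _ "(r, s, r')"]) auto
    then have "r \<otimes> s \<otimes> inv r' \<in> Z" using r' by (auto simp: Z_def)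
    then have "p \<otimes> (r \<otimes> s \<otimes> inv r') \<in> ?P" using pr by (auto intro: generate.incl)
    moreover have "q \<otimes> s = p \<otimes> (r \<otimes> s \<otimes> inv r') \<otimes> r'"
      using c r'c pr by (simp add: m_assoc)
    ultimately show ?thesis using r' by (auto simp: Q_def)
  qed
  have Qc: "Q \<subseteq> carrier G" using R by (auto simp: Q_def)
  have "q \<otimes> h \<in> Q" if "h \<in> generate G S" "q \<in> Q" for q h
    using that
  proof (induction arbitrary: q rule: generate.induct)
    case one
    then show ?case using Qc by auto
  next
    case (incl h)
    then show ?case using step by (auto simp: S'_def)
  next
    case (inv h)
    then show ?case using step by (auto simp: S'_def)
  next
    case (eng h1 h2)
    then have "q \<otimes> h1 \<otimes> h2 \<in> Q" by blast
    then show ?case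
      using m_assoc[of q h1 h2] eng.hyps eng.prems generate_in_carrier[OF S(2)] Qc by auto
  qed
  moreover have "\<one> \<otimes> \<one> \<in> Q"
    unfolding Q_def using R(3) P.one_closed by blast
  ultimately have "\<one> \<otimes> h \<in> Q" if "h \<in> generate G S" for h
    using that by simp
  then have "generate G S \<subseteq> Q"
    using generate_in_carrier[OF S(2)] by auto
  have "N \<inter> generate G S \<subseteq> ?P"
  proof
    fix g assume g: "g \<in> N \<inter> generate G S"
    then obtain p r where pr: "g = p \<otimes> r" "p \<in> ?P" "r \<in> R"
      using \<open>generate G S \<subseteq> Q\<close> by (auto simp: Q_def)
    have "p \<in> N" using pr generate_subgroup_incl[OF Z(2) N(1)] by blast
    have "r \<in> N"
    proof -
      have "r = inv p \<otimes> g" using pr R(2) by (auto simp: m_assoc[symmetric])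
      then show ?thesis using \<open>p \<in> N\<close> g by auto
    qed
    then have "r \<in> ?P" using pr by (auto simp: Z_def intro: generate.incl)
    then show "g \<in> ?P" using pr by auto
  qed
  then have "T closure_of (N \<inter> generate G S) \<subseteq> closed_span Z"
    unfolding closed_span_def by (rule closure_of_mono)
  \<comment> \<open>A dense subgroup meets the open set \<open>N\<close> in a dense subset of
    \<open>N\<close>.\<close>
  moreover have "N \<subseteq> T closure_of (N \<inter> generate G S)"
    using openin_Int_closure_of_subset[OF N(2), of "generate G S"] S(3) N.subset by blast
  ultimately show ?thesis using Z that by blast
qed

section \<open>Virtual independence as incomparability\<close>

lemma virtually_independentI:
  assumes fg: "topologically_finitely_generated G T"
    and x: "x \<in> carrier G" "x \<notin> closed_span {y}" and y: "y \<in> carrier G" "y \<notin> closed_span {x}"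
  shows "virtually_independent G T x y"
proof -
  have xy: "subgroup (closed_span {x}) G" "subgroup (closed_span {y}) G"
    using x y by (auto intro: subgroup_closed_span)
  obtain U where U: "subgroup U G" "openin T U" "closed_span {x} \<subseteq> U" "y \<notin> U"
    using closed_subgroup_separation[OF xy(1) closedin_closed_span y] .
  obtain V where V: "subgroup V G" "openin T V" "closed_span {y} \<subseteq> V" "x \<notin> V"
    using closed_subgroup_separation[OF xy(2) closedin_closed_span x] .
  have xU: "x \<in> U" and yV: "y \<in> V"
    using U V closed_span_superset[of "{x}"] closed_span_superset[of "{y}"] x y by auto
  define N where "N = U \<inter> V"
  have N: "subgroup N G" "openin T N"
    using U V by (auto simp: N_def intro: subgroups_Inter_pair)
  interpret N: subgroup N G by fact
  obtain Z where Z: "finite Z" "Z \<subseteq> N" "N \<subseteq> closed_span Z"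
    using open_subgroup_topologically_finitely_generated[OF fg N] .
  define H where "H = closed_span ({x, y} \<union> Z)"
  have gc: "{x, y} \<union> Z \<subseteq> carrier G" using x y Z by auto
  have "subgroup H G" unfolding H_def by (rule subgroup_closed_span[OF gc])
  moreover have "N \<subseteq> H"
    using Z closed_span_mono[of Z "{x, y} \<union> Z"] gc by (auto simp: H_def)
  ultimately have H: "subgroup H G" "openin T H"
    using openin_subgroupI N(2) N.one_closed by auto
  note gen = topologically_generates_open_subgroup_iff[OF H]
  \<comment> \<open>Only the finite set \<open>Z\<close> is thinned out; \<open>x\<close> and
    \<open>y\<close> are kept throughout.\<close>
  obtain Y where Y: "Y \<subseteq> Z" "closed_span ({x, y} \<union> Y) = H"
    and min: "\<And>W. W \<subset> Y \<Longrightarrow> closed_span ({x, y} \<union> W) \<noteq> H"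
    using finite_minimal_subset[OF Z(1), of "\<lambda>W. closed_span ({x, y} \<union> W) = H"] H_def
    by blast
  let ?X = "{x, y} \<union> Y"
  have XH: "?X \<subseteq> H" using closed_span_superset[OF gc] Y by (auto simp: H_def)
  have "closed_span W \<noteq> H" if W: "W \<subset> ?X" for W
  proof
    assume span: "closed_span W = H"
    \<comment> \<open>Everything in \<open>?X\<close> except \<open>x\<close> lies in the closed
      subgroup \<open>V\<close>, so without \<open>x\<close> the span would stay in
      \<open>V\<close>. The argument for \<open>y\<close> uses \<open>U\<close> in the same
      way.\<close>
    have "x \<in> W"
    proof (rule ccontr)
      assume "x \<notin> W"
      then have "W \<subseteq> V" using W Y(1) Z(2) yV by (auto simp: N_def)
      then have "H \<subseteq> V" using closed_span_minimal V closedin_open_subgroup span by blast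
      then show False using XH V by auto
    qed
    moreover have "y \<in> W"
    proof (rule ccontr)
      assume "y \<notin> W"
      then have "W \<subseteq> U" using W Y(1) Z(2) xU by (auto simp: N_def)
      then have "H \<subseteq> U" using closed_span_minimal U closedin_open_subgroup span by blast
      then show False using XH U by auto
    qed
    ultimately have "{x, y} \<union> (W \<inter> Y) = W" "W \<inter> Y \<subset> Y" using W by auto
    then show False using min[of "W \<inter> Y"] span by simp
  qed
  then have "minimal_generating_set (G\<lparr>carrier := H\<rparr>) (subtopology T H) ?X"
    using Y(2) XH by (auto simp: minimal_generating_set_def gen)
  then show ?thesis using H by (auto simp: virtually_independent_def)
qed

text \<open>Distinctness has to be stated on the left, as an element can share a minimal generating
  set with itself although it lies in its own closed span.\<close>

lemma virtually_independent_iff: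
  assumes "topologically_finitely_generated G T" "x \<in> carrier G" "y \<in> carrier G"
  shows "x \<noteq> y \<and> virtually_independent G T x y
    \<longleftrightarrow> x \<notin> closed_span {y} \<and> y \<notin> closed_span {x}"
proof (intro iffI conjI)
  assume "x \<noteq> y \<and> virtually_independent G T x y"
  then obtain H X where "subgroup H G" "openin T H"
    "minimal_generating_set (G\<lparr>carrier := H\<rparr>) (subtopology T H) X" "x \<in> X" "y \<in> X" "x \<noteq> y"
    by (auto simp: virtually_independent_def)
  then show "x \<notin> closed_span {y}" "y \<notin> closed_span {x}"
    using minimal_generating_set_not_in_closed_span[of H X] by metis+
next
  assume "x \<notin> closed_span {y} \<and> y \<notin> closed_span {x}"
  then show "x \<noteq> y" "virtually_independent G T x y"
    using closed_span_superset[of "{x}"] virtually_independentI assms by auto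
qed

section \<open>Short paths of incomparable elements\<close>

definition incomparable :: "'a \<Rightarrow> 'a \<Rightarrow> bool" where
  "incomparable x y \<longleftrightarrow> x \<in> carrier G \<and> y \<in> carrier G
     \<and> x \<notin> closed_span {y} \<and> y \<notin> closed_span {x}"

lemma incomparable_sym: "incomparable x y \<Longrightarrow> incomparable y x"
  by (auto simp: incomparable_def)

lemma incomparable_irrefl: "\<not> incomparable x x"
  using closed_span_superset[of "{x}"] by (auto simp: incomparable_def)

lemma closed_span_singleton_trans:
  "x \<in> closed_span {y} \<Longrightarrow> y \<in> closed_span {z} \<Longrightarrow> z \<in> carrier G \<Longrightarrow> x \<in> closed_span {z}"
  using closed_span_subset_closed_span[of "{y}" "{z}"] by blast

lemma incomparable_path_below:
  assumes xy: "x \<in> closed_span {y}" and xa: "incomparable x a" and yb: "incomparable y b"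
  shows "(\<exists>c. incomparable x c \<and> incomparable c y)
    \<or> (\<exists>c d. incomparable x c \<and> incomparable c d \<and> incomparable d y)"
proof -
  note trans = closed_span_singleton_trans
  have c: "x \<in> carrier G" "a \<in> carrier G" "y \<in> carrier G" "b \<in> carrier G"
    using xa yb by (auto simp: incomparable_def)
  have incs: "x \<notin> closed_span {a}" "a \<notin> closed_span {x}"
    "y \<notin> closed_span {b}" "b \<notin> closed_span {y}"
    using xa yb by (auto simp: incomparable_def)
  show ?thesis
  \<comment> \<open>The three alternatives give the paths x - b - y, x - a - y and x - a - b -
    y.\<close>
  proof (cases "incomparable x b \<or> incomparable a y \<or> incomparable a b")
    case True
    then show ?thesis using xa yb incomparable_sym by blast
  next
    case False
    \<comment> \<open>Each remaining pair is comparable, and one direction is excluded by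
      transitivity: b in <x> would give b in <y>, while y in <a> or b in <a> would give x in
      <a>.\<close>
    have xb: "x \<in> closed_span {b}"
      using False incs trans[OF _ xy] c unfolding incomparable_def by blast
    have ay: "a \<in> closed_span {y}"
      using False incs trans[OF xy] c unfolding incomparable_def by blast
    have ab: "a \<in> closed_span {b}"
      using False incs trans[OF xb] c unfolding incomparable_def by blast
    have sub: "subgroup (closed_span {x}) G" "subgroup (closed_span {a}) G"
      "subgroup (closed_span {y}) G"
      using c by (auto intro: subgroup_closed_span)
    obtain U where U: "subgroup U G" "openin T U" "closed_span {x} \<subseteq> U" "a \<notin> U"
      using closed_subgroup_separation[OF sub(1) closedin_closed_span c(2) incs(2)] .
    obtain V where V: "subgroup V G" "openin T V" "closed_span {a} \<subseteq> V" "x \<notin> V"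
      using closed_subgroup_separation[OF sub(2) closedin_closed_span c(1) incs(1)] .
    have "x \<in> U" "a \<in> V"
      using U V closed_span_superset[of "{x}"] closed_span_superset[of "{a}"] c by auto
    then obtain b1 b2 where b12: "b1 \<in> closed_span {b}" "b2 \<in> closed_span {b}" "b = b1 \<otimes> b2"
      "a \<notin> closed_span {b1}" "x \<notin> closed_span {b2}"
      using procyclic_split[OF c(4) ab xb U(1,2) _ U(4) V(1,2) _ V(4)] by blast
    have bc: "b1 \<in> carrier G" "b2 \<in> carrier G"
      using b12 subgroup.subset[OF subgroup_closed_span[of "{b}"]] c by auto
    show ?thesis
    proof (cases "b1 \<in> closed_span {y}")
      case False
      \<comment> \<open>If y were in <b1>, it would be in <b>. For the next pair, b1 in <a> would
        give b1 in <y>.\<close>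
      have "incomparable b1 y"
        using False incs(3) b12(1) trans c bc unfolding incomparable_def by blast
      moreover have "incomparable a b1"
        using False b12(4) ay trans c bc unfolding incomparable_def by blast
      ultimately show ?thesis using xa by blast
    next
      case True
      \<comment> \<open><y> is a subgroup, so it cannot contain both factors of
        \<open>b\<close>.\<close>
      then have b2: "b2 \<notin> closed_span {y}"
        using b12(3) incs(4) subgroup.m_closed[OF sub(3)] by blast
      have "incomparable b2 y"
        using b2 incs(3) b12(2) trans c bc unfolding incomparable_def by blast
      moreover have "incomparable x b2"
        using b2 b12(5) xy trans c bc unfolding incomparable_def by blast
      ultimately show ?thesis by blast
    qed
  qed
qed

lemma incomparable_path:
  assumes "incomparable x a" "incomparable y b"
  shows "incomparable x y \<or> (\<exists>c. incomparable x c \<and> incomparable c y)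
    \<or> (\<exists>c d. incomparable x c \<and> incomparable c d \<and> incomparable d y)"
proof -
  consider "x \<in> closed_span {y}" | "y \<in> closed_span {x}" | "incomparable x y"
    using assms by (auto simp: incomparable_def)
  then show ?thesis
  proof cases
    case 1
    from incomparable_path_below[OF this assms] show ?thesis by blast
  next
    case 2
    from incomparable_path_below[OF this assms(2,1)] show ?thesis
      using incomparable_sym by blast
  qed blast
qed

end

section \<open>Paths in the graph\<close>

text \<open>An \<open>apath\<close> must not repeat vertices, whereas the given chain of edges may.
  The empty path settles \<open>u = v\<close>; otherwise the cases exclude shorter connections, and
  together with irreflexivity this makes the vertices distinct.\<close>

lemma ex_apath_length_le_3:
  fixes \<Gamma> :: "('a, 'a \<times> 'a) pre_digraph"
  assumes td: "tail \<Gamma> = fst" "head \<Gamma> = snd"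
    and arcs: "\<And>v w. (v, w) \<in> arcs \<Gamma> \<longleftrightarrow> E v w" and verts: "\<And>v w. E v w \<Longrightarrow> w \<in> verts \<Gamma>"
    and uv: "u \<in> verts \<Gamma>" "v \<in> verts \<Gamma>" and irrefl: "\<And>v. \<not> E v v"
    and path: "E u v \<or> (\<exists>c. E u c \<and> E c v) \<or> (\<exists>c d. E u c \<and> E c d \<and> E d v)"
  shows "\<exists>p. pre_digraph.apath \<Gamma> u p v \<and> length p \<le> 3"
proof -
  note simps = pre_digraph.apath_def pre_digraph.awalk_def pre_digraph.cas.simps
    pre_digraph.awalk_verts.simps
  have nil: "pre_digraph.apath \<Gamma> v [] v" using uv by (simp add: simps)
  consider "u = v" | "u \<noteq> v" "E u v" | c where "u \<noteq> v" "\<not> E u v" "E u c" "E c v"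
    | c d where "u \<noteq> v" "\<not> E u v" "\<not> (\<exists>c. E u c \<and> E c v)" "E u c" "E c d" "E d v"
    using path by blast
  then show ?thesis
  proof cases
    case 1
    then show ?thesis using nil by (intro exI[of _ "[]"]) simp
  next
    case 2
    then show ?thesis using uv by (intro exI[of _ "[(u, v)]"]) (auto simp: simps td arcs)
  next
    case 3
    then show ?thesis using uv irrefl
      by (intro exI[of _ "[(u, c), (c, v)]"]) (auto simp: simps td arcs)
  next
    case 4
    then show ?thesis using uv irrefl
      by (intro exI[of _ "[(u, c), (c, d), (d, v)]"]) (auto simp: simps td arcs)
  qed
qed

theorem theorem4:
  fixes G :: "('a, 'b) monoid_scheme" and T :: "'a topology"
  assumes "profinite_group G T"
    and "topologically_finitely_generated G T"
  shows "connected_graph (nonisolated_virtual_independence_graph G T)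
    \<and> graph_diameter (nonisolated_virtual_independence_graph G T) \<le> 3"
proof -
  interpret profinite_group G T by fact
  let ?D = "nonisolated_virtual_independence_graph G T"
  note defs = nonisolated_virtual_independence_graph_def nonisolated_subgraph_def
    virtual_independence_graph_def
  have E: "(x, y) \<in> arcs (virtual_independence_graph G T) \<longleftrightarrow> incomparable x y" for x y
    using virtually_independent_iff[OF assms(2), of x y]
    unfolding virtual_independence_graph_def incomparable_def by simp blast
  have ends: "(x, y) \<in> arcs_ends (virtual_independence_graph G T) \<longleftrightarrow> incomparable x y" for x y
    unfolding E[symmetric] by (force simp: virtual_independence_graph_def arcs_ends_def arc_to_ends_def)
  have verts: "x \<in> verts ?D \<longleftrightarrow> (\<exists>a. incomparable x a)" for x
    unfolding nonisolated_virtual_independence_graph_def nonisolated_subgraph_def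
    by (auto simp: ends) (auto simp: virtual_independence_graph_def incomparable_def)
  \<comment> \<open>Passing to the induced subgraph loses no arc, as both ends of an arc are
    non-isolated.\<close>
  have arcs: "(x, y) \<in> arcs ?D \<longleftrightarrow> incomparable x y" for x y
  proof -
    have "(x, y) \<in> arcs ?D \<longleftrightarrow> (x, y) \<in> arcs (virtual_independence_graph G T)
        \<and> x \<in> verts ?D \<and> y \<in> verts ?D"
      by (auto simp: defs)
    then show ?thesis unfolding E verts using incomparable_sym by blast
  qed
  have path: "\<exists>p. pre_digraph.apath ?D x p y \<and> length p \<le> 3"
    if xy: "x \<in> verts ?D" "y \<in> verts ?D" for x y
  proof (rule ex_apath_length_le_3[where E = incomparable])
    show "tail ?D = fst" "head ?D = snd" by (simp_all add: defs)
    show "w \<in> verts ?D" if "incomparable v w" for v w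
      using that incomparable_sym verts by blast
    show "incomparable x y \<or> (\<exists>c. incomparable x c \<and> incomparable c y)
      \<or> (\<exists>c d. incomparable x c \<and> incomparable c d \<and> incomparable d y)"
      using xy incomparable_path unfolding verts by blast
  qed (use xy arcs incomparable_irrefl in auto)
  have "graph_distance ?D x y \<le> 3" if xy: "x \<in> verts ?D" "y \<in> verts ?D" for x y
  proof -
    obtain p where p: "pre_digraph.apath ?D x p y" "length p \<le> 3" using path[OF xy] by blast
    have "graph_distance ?D x y \<le> enat (length p)"
      unfolding graph_distance_def using p by (intro INF_lower) auto
    also have "\<dots> \<le> 3" using p by (simp add: numeral_eq_enat)
    finally show ?thesis .
  qed
  then have "graph_diameter ?D \<le> 3"
    unfolding graph_diameter_def by (intro SUP_least)
  moreover have "connected_graph ?D"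
    using path unfolding connected_graph_def by blast
  ultimately show ?thesis by blast
qed

end
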